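(* Let $G$ be the complete graph on the vertex set $\{0,1\}^2\setminus\{10\}=\{00,01,11\}$ (i.e. its edges are $\{00,01\},\{00,11\},\{01,11\}$). Then $$C_M(G)=\log_2\beta\approx 0.849,$$ where $\beta^{-1}$ is the unique positive root of the equation $x+\frac{x^2}{1-x^2}=1$.
   Context: Let $H$ be a simple graph whose vertex set is $\{0,1\}^2$, the set of ordered pairs of binary symbols (written as strings $ab$), or a subset of it, and whose edges are unordered pairs of distinct vertices. Two sequences $\mathbf{x}=(x_1,\dots,x_n),\mathbf{y}=(y_1,\dots,y_n)\in\{0,1\}^n$ are called distinguishable for $H$ if there exists $i\in\{1,\dots,n-1\}$ such that $\{x_ix_{i+1},\,y_iy_{i+1}\}$ is an edge of $H$. Let $M(H,n)$ be the largest cardinality of a set $C\subseteq\{0,1\}^n$ any two distinct elements of which are distinguishable for $H$. The Shannon–Markov capacity of $H$ is $C_M(H)=\limsup_{n\to\infty}\frac1n\log_2 M(H,n)$.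
   Formalization: The equation has two positive roots (about 0.555 and 2.247), so "unique positive root" is read as the unique root in the interval (0,1); "≈ 0.849" is stated as 0.849 ≤ log₂β < 0.850. *)

theory Defs
  imports "HOL-Analysis.Analysis"
begin

(* The binary symbols 0 and 1 are False and True; the string ab is the pair (a, b).
   A graph is a pair of a vertex set and a set of two-element edges. *)

type_synonym 'a graph = "'a set \<times> 'a set set"

definition simple_graph :: "'a graph \<Rightarrow> bool" where
  "simple_graph H \<longleftrightarrow>
     (\<forall>e \<in> snd H. \<exists>u \<in> fst H. \<exists>v \<in> fst H. u \<noteq> v \<and> e = {u, v})"

definition complete_graph :: "'a set \<Rightarrow> 'a graph" where
  "complete_graph V = (V, {{u, v} | u v. u \<in> V \<and> v \<in> V \<and> u \<noteq> v})"

(* List positions are counted from 0. Used for lists of equal length only. *)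
definition distinguishable :: "(bool \<times> bool) graph \<Rightarrow> bool list \<Rightarrow> bool list \<Rightarrow> bool" where
  "distinguishable H x y \<longleftrightarrow>
     (\<exists>i. i + 1 < length x \<and> {(x ! i, x ! (i + 1)), (y ! i, y ! (i + 1))} \<in> snd H)"

definition max_code_size :: "(bool \<times> bool) graph \<Rightarrow> nat \<Rightarrow> nat" where
  "max_code_size H n =
     Max {card C | C. C \<subseteq> {x. length x = n} \<and> pairwise (distinguishable H) C}"

definition shannon_markov_capacity :: "(bool \<times> bool) graph \<Rightarrow> ereal" where
  "shannon_markov_capacity H =
     limsup (\<lambda>n. ereal (1 / real n * log 2 (real (max_code_size H n))))"

definition G :: "(bool \<times> bool) graph" where
  "G = complete_graph (UNIV - {(True, False)})"

lemma simple_graph_complete_graph: "simple_graph (complete_graph V)"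
  by (auto simp: simple_graph_def complete_graph_def)

lemma G_vertices: "fst G = {(False, False), (False, True), (True, True)}"
  by (auto simp: G_def complete_graph_def)

lemma G_edges:
  "snd G = {{(False, False), (False, True)}, {(False, False), (True, True)},
            {(False, True), (True, True)}}"
proof -
  have complete3: "{{u, v} | u v. u \<in> {a, b, c} \<and> v \<in> {a, b, c} \<and> u \<noteq> v}
      = {{a, b}, {a, c}, {b, c}}" if "a \<noteq> b" "a \<noteq> c" "b \<noteq> c" for a b c :: "bool \<times> bool"
    using that by blast
  have "snd G = {{u, v} | u v. u \<in> fst G \<and> v \<in> fst G \<and> u \<noteq> v}"
    by (simp add: G_def complete_graph_def)
  then show ?thesis
    unfolding G_vertices by (simp only:) (rule complete3; simp)
qed

lemma finite_code_sizes:
  "finite {card C | C. C \<subseteq> {x. length x = n} \<and> pairwise (distinguishable H) C}"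
proof -
  have "finite {x :: bool list. length x = n}"
    using finite_lists_length_eq[of "UNIV :: bool set" n] by simp
  then have "finite (card ` Pow {x :: bool list. length x = n})"
    by blast
  then show ?thesis
    by (rule rev_finite_subset) auto
qed

lemma max_code_size_pos: "max_code_size H n \<ge> 1"
proof -
  have "1 \<in> {card C | C. C \<subseteq> {x. length x = n} \<and> pairwise (distinguishable H) C}"
    by (rule CollectI, rule exI[of _ "{replicate n False}"]) (simp add: pairwise_def)
  then show ?thesis
    unfolding max_code_size_def by (rule Max_ge[OF finite_code_sizes])
qed

end

theory Submission
  imports Defs "HOL-Library.Landau_Symbols"
begin

text \<open>
  Call a word odd if all its maximal runs of ones have odd length. Two odd words, preceded by a
  common 0, are distinguishable: at the first difference either the previous symbol is 0 and the
  pairs 01, 00 separate them, or one word has just closed an odd run of ones, so that the other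
  must go on with 11, and the next pairs are 11 and one of 00, 01.
  Conversely, turning the last 1 of every even run into 0 maps every word to an odd one. It only
  replaces pairs 11 by 10 and the following 10 by 00, so two words with the same image never show
  two different vertices at the same place, and distinguishable words have different images.
  Up to its end, an odd word is a concatenation of blocks 0, 10, 1110, \<open>\<dots>\<close>, whose lengths have the
  generating function \<open>x + x\<^sup>2 / (1 - x\<^sup>2)\<close>; hence the growth rate \<open>\<beta>\<close>.
\<close>

subsection \<open>Code sizes and capacity\<close>

lemma tendsto_log_growth_rate:
  fixes f :: "nat \<Rightarrow> real"
  assumes growth: "f \<in> \<Theta>(\<lambda>n. \<beta> ^ n)"
    and pos: "\<forall>\<^sub>F n in sequentially. 0 < f n" "0 < \<beta>" and base: "1 < b"
  shows "(\<lambda>n. 1 / real n * log b (f n)) \<longlonglongrightarrow> log b \<beta>"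
proof -
  obtain c where lower: "0 < c" "\<forall>\<^sub>F n in sequentially. c * norm (\<beta> ^ n) \<le> norm (f n)"
    using bigthetaD2[OF growth] by (rule landau_omega.bigE)
  obtain C where upper: "0 < C" "\<forall>\<^sub>F n in sequentially. norm (f n) \<le> C * norm (\<beta> ^ n)"
    using bigthetaD1[OF growth] by (rule landau_o.bigE)
  define ratio where "ratio n = f n / \<beta> ^ n" for n
  have log_ratio_bounds:
    "\<forall>\<^sub>F n in sequentially. log b c \<le> log b (ratio n) \<and> log b (ratio n) \<le> log b C"
    using lower(2) upper(2) pos(1)
  proof eventually_elim
    case (elim n)
    then have "c \<le> ratio n" "ratio n \<le> C"
      using pos(2) by (simp_all add: ratio_def field_simps)
    with \<open>0 < c\<close> base show ?case by simp
  qed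
  have "(\<lambda>n. log b (ratio n) / real n) \<longlonglongrightarrow> 0"
    by (rule tendsto_sandwich[OF _ _ lim_const_over_n[of "log b c"] lim_const_over_n[of "log b C"]];
        use log_ratio_bounds in eventually_elim; simp add: divide_right_mono)
  then have "(\<lambda>n. log b (ratio n) / real n + log b \<beta>) \<longlonglongrightarrow> log b \<beta>"
    using tendsto_add[OF _ tendsto_const] by fastforce
  moreover have "\<forall>\<^sub>F n in sequentially.
      log b (ratio n) / real n + log b \<beta> = 1 / real n * log b (f n)"
    using pos(1) eventually_gt_at_top[of 0]
    by eventually_elim (use pos(2) in \<open>simp add: ratio_def log_divide log_nat_power field_simps\<close>)
  ultimately show ?thesis
    by (rule Lim_transform_eventually)
qed

lemma shannon_markov_capacity_eq_log:
  assumes "(\<lambda>n. real (max_code_size H n)) \<in> \<Theta>(\<lambda>n. \<beta> ^ n)" "0 < \<beta>"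
  shows "shannon_markov_capacity H = ereal (log 2 \<beta>)"
proof -
  have "\<forall>\<^sub>F n in sequentially. 0 < real (max_code_size H n)"
    using max_code_size_pos[of H] by (simp add: Suc_le_eq)
  then have "(\<lambda>n. 1 / real n * log 2 (real (max_code_size H n))) \<longlonglongrightarrow> log 2 \<beta>"
    using assms by (intro tendsto_log_growth_rate) auto
  then show ?thesis
    unfolding shannon_markov_capacity_def by (intro lim_imp_Limsup) auto
qed

lemma card_le_max_code_size:
  assumes "C \<subseteq> {x. length x = n}" "pairwise (distinguishable H) C"
  shows "card C \<le> max_code_size H n"
  unfolding max_code_size_def using assms by (intro Max_ge[OF finite_code_sizes]) blast

lemma max_code_size_le_card:
  assumes "finite W" and maps_into: "\<And>x. length x = n \<Longrightarrow> f x \<in> W"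
    and separates:
      "\<And>x y. length x = n \<Longrightarrow> length y = n \<Longrightarrow> distinguishable H x y \<Longrightarrow> f x \<noteq> f y"
  shows "max_code_size H n \<le> card W"
proof -
  have "card C \<le> card W"
    if code: "C \<subseteq> {x. length x = n}" "pairwise (distinguishable H) C" for C
  proof (rule card_inj_on_le)
    show "inj_on f C"
    proof (rule inj_onI, rule ccontr)
      fix x y
      assume "x \<in> C" "y \<in> C" "f x = f y" "x \<noteq> y"
      with code show False
        using separates[of x y] by (auto dest: pairwiseD)
    qed
  qed (use code maps_into \<open>finite W\<close> in auto)
  moreover have "\<exists>C. C \<subseteq> {x :: bool list. length x = n} \<and> pairwise (distinguishable H) C"
    by (rule exI[of _ "{}"]) simp
  ultimately show ?thesis
    unfolding max_code_size_def by (intro Max.boundedI[OF finite_code_sizes]) auto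
qed

lemma distinguishable_short [simp]:
  "\<not> distinguishable H [] y" "\<not> distinguishable H [a] y"
  by (simp_all add: distinguishable_def)

lemma distinguishable_Cons_Cons [simp]:
  "distinguishable H (a # b # x) (c # d # y) \<longleftrightarrow>
     {(a, b), (c, d)} \<in> snd H \<or> distinguishable H (b # x) (d # y)"
  by (simp add: distinguishable_def Ex_less_Suc2)

lemma distinguishable_Cons_same_head:
  assumes "simple_graph H" "take 1 x = take 1 y"
  shows "distinguishable H (a # x) (a # y) \<longleftrightarrow> distinguishable H x y"
proof -
  have "{u} \<notin> snd H" for u
    using assms(1) unfolding simple_graph_def by force
  with assms(2) show ?thesis
    by (cases x; cases y) auto
qed

lemma edge_complete_graph_iff:
  "{u, v} \<in> snd (complete_graph V) \<longleftrightarrow> u \<in> V \<and> v \<in> V \<and> u \<noteq> v"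
  by (auto simp: complete_graph_def doubleton_eq_iff)

lemma edge_G_iff [simp]:
  "{u, v} \<in> snd G \<longleftrightarrow> u \<noteq> v \<and> u \<noteq> (True, False) \<and> v \<noteq> (True, False)"
  unfolding G_def edge_complete_graph_iff by blast

lemma singleton_not_edge_G [simp]: "{u} \<notin> snd G"
  using edge_G_iff[of u u] by simp

subsection \<open>Words with odd runs of ones\<close>

fun odd_runs :: "bool list \<Rightarrow> bool" where
  "odd_runs [] \<longleftrightarrow> True"
| "odd_runs (False # x) \<longleftrightarrow> odd_runs x"
| "odd_runs [True] \<longleftrightarrow> True"
| "odd_runs (True # False # x) \<longleftrightarrow> odd_runs x"
| "odd_runs [True, True] \<longleftrightarrow> False"
| "odd_runs (True # True # False # x) \<longleftrightarrow> False"
| "odd_runs (True # True # True # x) \<longleftrightarrow> odd_runs (True # x)"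

fun trim_even_runs :: "bool list \<Rightarrow> bool list" where
  "trim_even_runs [] = []"
| "trim_even_runs (False # x) = False # trim_even_runs x"
| "trim_even_runs [True] = [True]"
| "trim_even_runs (True # False # x) = True # False # trim_even_runs x"
| "trim_even_runs [True, True] = [True, False]"
| "trim_even_runs (True # True # False # x) = True # False # False # trim_even_runs x"
| "trim_even_runs (True # True # True # x) = True # True # trim_even_runs (True # x)"

lemmas trim_even_runs_induct = trim_even_runs.induct
  [case_names empty zero one one_zero one_one one_one_zero one_one_one]

lemmas trim_even_runs_cases = trim_even_runs.cases
  [case_names empty zero one one_zero one_one one_one_zero one_one_one]

lemma odd_runs_distinguishable:
  assumes "odd_runs x" "odd_runs y" "length x = length y" "x \<noteq> y"
  shows "distinguishable G (False # x) (False # y)"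
  using assms
proof (induction x arbitrary: y rule: trim_even_runs_induct)
  case (zero x)
  then obtain b z where "y = b # z" by (cases y) auto
  with zero show ?case by (cases b) auto
next
  case one
  then show ?case by (cases y rule: trim_even_runs_cases) auto
next
  case (one_zero x)
  then show ?case by (cases y rule: trim_even_runs_cases; cases x) auto
next
  case (one_one_one x)
  have "odd_runs (True # x)"
    using one_one_one.prems(1) by simp
  from one_one_one.prems consider (zero) z where "y = False # z"
    | (one_zero) b z where "y = True # False # b # z"
    | (one_one_one) z where
        "y = True # True # True # z" "odd_runs (True # z)" "length x = length z" "x \<noteq> z"
    by (cases y rule: trim_even_runs_cases; cases "tl (tl y)") auto
  then show ?case
  proof cases
    case (one_one_one z)
    have "distinguishable G (False # True # x) (False # True # z)"
      by (rule one_one_one.IH) (simp_all add: one_one_one \<open>odd_runs (True # x)\<close>)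
    with one_one_one show ?thesis by simp
  qed simp_all
qed auto

lemma length_trim_even_runs [simp]: "length (trim_even_runs x) = length x"
  by (induction x rule: trim_even_runs_induct) auto

lemma take_1_trim_even_runs: "take 1 (trim_even_runs x) = take 1 x"
  by (cases x rule: trim_even_runs_cases) auto

lemma odd_runs_trim_even_runs: "odd_runs (trim_even_runs x)"
proof (induction x rule: trim_even_runs_induct)
  case (one_one_one x)
  obtain z where "trim_even_runs (True # x) = True # z"
    using take_1_trim_even_runs[of "True # x"] by (cases "trim_even_runs (True # x)") auto
  with one_one_one show ?case by simp
qed auto

lemma distinguishable_Cons_trim_even_runs_eq:
  assumes "trim_even_runs x = trim_even_runs y"
  shows "distinguishable G (a # x) (a # y) \<longleftrightarrow> distinguishable G x y"
proof (rule distinguishable_Cons_same_head)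
  show "simple_graph G"
    unfolding G_def by (rule simple_graph_complete_graph)
  show "take 1 x = take 1 y"
    using assms take_1_trim_even_runs by metis
qed

lemma trim_even_runs_eq_imp_not_distinguishable:
  assumes "trim_even_runs x = trim_even_runs y"
  shows "\<not> distinguishable G x y"
  using assms
proof (induction x arbitrary: y rule: trim_even_runs_induct)
  case (zero x)
  then obtain z where "y = False # z" "trim_even_runs x = trim_even_runs z"
    by (cases y rule: trim_even_runs_cases) auto
  with zero.IH show ?case
    by (simp add: distinguishable_Cons_trim_even_runs_eq)
next
  case (one_zero x)
  then consider (one_zero) z where "y = True # False # z" "trim_even_runs x = trim_even_runs z"
    | (one_one) "y = [True, True]" "x = []"
    | (one_one_zero) w z where "y = True # True # False # z" "x = False # w"
        "trim_even_runs x = trim_even_runs (False # z)"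
    by (cases y rule: trim_even_runs_cases; cases x rule: trim_even_runs_cases) auto
  then show ?case
  proof cases
    case (one_one_zero w z)
    with one_zero.IH[of "False # z"] show ?thesis
      by (simp add: distinguishable_Cons_trim_even_runs_eq)
  qed (use one_zero.IH in \<open>auto simp: distinguishable_Cons_trim_even_runs_eq\<close>)
next
  case one
  then show ?case
    by (cases y rule: trim_even_runs_cases) auto
next
  case one_one
  then show ?case
    by (cases y rule: trim_even_runs_cases) auto
next
  case (one_one_zero x)
  then consider (one_zero) z where
      "y = True # False # False # z" "trim_even_runs x = trim_even_runs z"
    | (one_one_zero) z where
      "y = True # True # False # z" "trim_even_runs x = trim_even_runs z"
    by (cases y rule: trim_even_runs_cases; cases "tl (tl y)" rule: trim_even_runs_cases) auto
  then show ?case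
    by cases (use one_one_zero.IH in \<open>auto simp: distinguishable_Cons_trim_even_runs_eq\<close>)
next
  case (one_one_one x)
  then show ?case
    by (cases y rule: trim_even_runs_cases) auto
qed simp_all

subsection \<open>Counting words with odd runs\<close>

definition odd_run_words :: "nat \<Rightarrow> bool list set" where
  "odd_run_words n = {x. length x = n \<and> odd_runs x}"

definition odd_run_tails :: "nat \<Rightarrow> bool list set" where
  "odd_run_tails n = {x. length x = n \<and> odd_runs (True # x)}"

lemma finite_bool_lists_length: "finite {x :: bool list. length x = n}"
  using finite_lists_length_eq[of "UNIV :: bool set" n] by simp

lemma finite_odd_run_sets [simp]: "finite (odd_run_words n)" "finite (odd_run_tails n)"
  by (rule finite_subset[OF _ finite_bool_lists_length[of n]];
      auto simp: odd_run_words_def odd_run_tails_def)+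

lemma max_code_size_G_le: "max_code_size G n \<le> card (odd_run_words n)"
proof (rule max_code_size_le_card[OF finite_odd_run_sets(1)])
  fix x y :: "bool list"
  assume "distinguishable G x y"
  then show "trim_even_runs x \<noteq> trim_even_runs y"
    using trim_even_runs_eq_imp_not_distinguishable by blast
qed (simp_all add: odd_run_words_def odd_runs_trim_even_runs)

lemma max_code_size_G_ge: "card (odd_run_words n) \<le> max_code_size G (Suc n)"
proof -
  have "card ((#) False ` odd_run_words n) \<le> max_code_size G (Suc n)"
  proof (rule card_le_max_code_size)
    show "pairwise (distinguishable G) ((#) False ` odd_run_words n)"
      using odd_runs_distinguishable by (auto simp: pairwise_def odd_run_words_def)
  qed (auto simp: odd_run_words_def)
  then show ?thesis by (simp add: card_image)
qed

lemma card_odd_run_words_0: "card (odd_run_words 0) = 1"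
proof -
  have "odd_run_words 0 = {[]}" by (auto simp: odd_run_words_def)
  then show ?thesis by simp
qed

lemma card_odd_run_words_Suc:
  "card (odd_run_words (Suc n)) = card (odd_run_words n) + card (odd_run_tails n)"
proof -
  have "odd_run_words (Suc n) = (#) False ` odd_run_words n \<union> (#) True ` odd_run_tails n"
  proof (rule set_eqI)
    show "x \<in> odd_run_words (Suc n) \<longleftrightarrow>
        x \<in> (#) False ` odd_run_words n \<union> (#) True ` odd_run_tails n" for x
      by (cases x; cases "hd x") (auto simp: odd_run_words_def odd_run_tails_def image_iff)
  qed
  moreover have "disjnt ((#) False ` odd_run_words n) ((#) True ` odd_run_tails n)"
    by (auto simp: disjnt_iff)
  ultimately show ?thesis
    by (simp add: card_Un_disjnt card_image)
qed

lemma card_odd_run_tails_0: "card (odd_run_tails 0) = 1"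
proof -
  have "odd_run_tails 0 = {[]}" by (auto simp: odd_run_tails_def)
  then show ?thesis by simp
qed

lemma card_odd_run_tails_1: "card (odd_run_tails (Suc 0)) = 1"
proof -
  have "odd_run_tails (Suc 0) = {[False]}"
    by (auto simp: odd_run_tails_def length_Suc_conv)
  then show ?thesis by simp
qed

lemma card_odd_run_tails_Suc_Suc:
  "card (odd_run_tails (Suc (Suc n))) = card (odd_run_words (Suc n)) + card (odd_run_tails n)"
proof -
  have "odd_run_tails (Suc (Suc n)) =
      (#) False ` odd_run_words (Suc n) \<union> (\<lambda>x. True # True # x) ` odd_run_tails n"
  proof (rule set_eqI)
    show "x \<in> odd_run_tails (Suc (Suc n)) \<longleftrightarrow>
        x \<in> (#) False ` odd_run_words (Suc n) \<union> (\<lambda>x. True # True # x) ` odd_run_tails n" for x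
      by (cases x rule: trim_even_runs_cases)
        (auto simp: odd_run_words_def odd_run_tails_def image_iff)
  qed
  moreover have
    "disjnt ((#) False ` odd_run_words (Suc n)) ((\<lambda>x. True # True # x) ` odd_run_tails n)"
    by (auto simp: disjnt_iff)
  ultimately show ?thesis
    by (simp add: card_Un_disjnt card_image inj_on_def)
qed

text \<open>The coefficients form the left \<open>\<beta>\<close>-eigenvector of the two recurrences above.\<close>

lemma odd_run_potential_eq:
  fixes \<beta> :: real
  assumes "(\<beta>\<^sup>2 - 1) * (\<beta> - 1) = \<beta>"
  shows "(\<beta>\<^sup>2 - 1) * card (odd_run_words (Suc n)) + \<beta> * card (odd_run_tails (Suc n))
      + card (odd_run_tails n) = (2 * \<beta>\<^sup>2 + \<beta> - 1) * \<beta> ^ n"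
    (is "?potential n = _")
proof (induction n)
  case 0
  show ?case
    by (simp add: card_odd_run_words_Suc card_odd_run_words_0 card_odd_run_tails_0
        card_odd_run_tails_1)
next
  case (Suc n)
  have "?potential (Suc n) - \<beta> * ?potential n =
      (\<beta> - (\<beta>\<^sup>2 - 1) * (\<beta> - 1)) * card (odd_run_words (Suc n))"
    by (simp add: card_odd_run_words_Suc[of "Suc n"] card_odd_run_tails_Suc_Suc
        algebra_simps power2_eq_square)
  with Suc.IH assms show ?case by simp
qed

lemma card_odd_run_words_le:
  fixes \<beta> :: real
  assumes "(\<beta>\<^sup>2 - 1) * (\<beta> - 1) = \<beta>" "1 < \<beta>"
  shows "(\<beta>\<^sup>2 - 1) * card (odd_run_words n) \<le> (2 * \<beta>\<^sup>2 + \<beta> - 1) * \<beta> ^ n"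
proof -
  have "(\<beta>\<^sup>2 - 1) * card (odd_run_words n) \<le> (\<beta>\<^sup>2 - 1) * card (odd_run_words (Suc n))"
    using assms(2) by (simp add: card_odd_run_words_Suc)
  also have "\<dots> \<le> (2 * \<beta>\<^sup>2 + \<beta> - 1) * \<beta> ^ n"
    unfolding odd_run_potential_eq[OF assms(1), symmetric] using assms(2) by simp
  finally show ?thesis .
qed

lemma card_odd_run_words_ge:
  fixes \<beta> :: real
  assumes "(\<beta>\<^sup>2 - 1) * (\<beta> - 1) = \<beta>" "1 < \<beta>"
  shows "(2 * \<beta>\<^sup>2 + \<beta> - 1) * \<beta> ^ n \<le> (\<beta>\<^sup>2 + \<beta>) * card (odd_run_words (Suc (Suc n)))"
proof -
  let ?a = "real (card (odd_run_words (Suc (Suc n))))"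
  have "card (odd_run_words (Suc n)) \<le> ?a" "card (odd_run_tails (Suc n)) \<le> ?a"
    "card (odd_run_tails n) \<le> ?a"
    by (simp_all add: card_odd_run_words_Suc)
  then have "(\<beta>\<^sup>2 - 1) * card (odd_run_words (Suc n)) + \<beta> * card (odd_run_tails (Suc n))
      + card (odd_run_tails n) \<le> (\<beta>\<^sup>2 - 1) * ?a + \<beta> * ?a + ?a"
    using assms(2) by (intro add_mono mult_left_mono) auto
  then show ?thesis
    unfolding odd_run_potential_eq[OF assms(1)] by (simp add: algebra_simps)
qed

lemma max_code_size_G_bigo:
  fixes \<beta> :: real
  assumes "(\<beta>\<^sup>2 - 1) * (\<beta> - 1) = \<beta>" "1 < \<beta>"
  shows "(\<lambda>n. real (max_code_size G n)) \<in> O(\<lambda>n. \<beta> ^ n)"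
proof (rule bigoI, intro always_eventually allI)
  fix n
  have "0 < \<beta>\<^sup>2 - 1"
    using assms(2) by (simp add: one_less_power)
  then have "(\<beta>\<^sup>2 - 1) * max_code_size G n \<le> (\<beta>\<^sup>2 - 1) * card (odd_run_words n)"
    using max_code_size_G_le[of n] by simp
  also note card_odd_run_words_le[OF assms]
  finally show "norm (real (max_code_size G n)) \<le>
      (2 * \<beta>\<^sup>2 + \<beta> - 1) / (\<beta>\<^sup>2 - 1) * norm (\<beta> ^ n)"
    using \<open>0 < \<beta>\<^sup>2 - 1\<close> assms(2) by (simp add: field_simps)
qed

lemma max_code_size_G_bigomega:
  fixes \<beta> :: real
  assumes "(\<beta>\<^sup>2 - 1) * (\<beta> - 1) = \<beta>" "1 < \<beta>"
  shows "(\<lambda>n. real (max_code_size G n)) \<in> \<Omega>(\<lambda>n. \<beta> ^ n)"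
proof (rule landau_omega.bigI)
  have "1 < \<beta>\<^sup>2"
    using assms(2) by (simp add: one_less_power)
  then have "0 < 2 * \<beta>\<^sup>2 + \<beta> - 1"
    using assms(2) by linarith
  then show "0 < (2 * \<beta>\<^sup>2 + \<beta> - 1) / ((\<beta>\<^sup>2 + \<beta>) * \<beta> ^ 3)"
    using assms(2) by simp
  show "\<forall>\<^sub>F n in sequentially. (2 * \<beta>\<^sup>2 + \<beta> - 1) / ((\<beta>\<^sup>2 + \<beta>) * \<beta> ^ 3) * norm (\<beta> ^ n) \<le>
      norm (real (max_code_size G n))"
    using eventually_ge_at_top[of 3]
  proof eventually_elim
    case (elim n)
    then obtain m where n_eq: "n = m + 3"
      using le_Suc_ex by (metis add.commute)
    note card_odd_run_words_ge[OF assms, of m]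
    also have "(\<beta>\<^sup>2 + \<beta>) * card (odd_run_words (Suc (Suc m))) \<le> (\<beta>\<^sup>2 + \<beta>) * max_code_size G n"
      using assms(2) max_code_size_G_ge[of "Suc (Suc m)"]
      by (intro mult_left_mono) (simp_all add: n_eq eval_nat_numeral)
    finally have "(2 * \<beta>\<^sup>2 + \<beta> - 1) * \<beta> ^ m / (\<beta>\<^sup>2 + \<beta>) \<le> max_code_size G n"
      using assms(2) by (simp add: pos_divide_le_eq add_pos_pos mult.commute)
    then show ?case
      using assms(2) by (simp add: n_eq power_add)
  qed
qed

subsection \<open>The root of the block equation\<close>

definition block_gf :: "real \<Rightarrow> real" where
  "block_gf x = x + x\<^sup>2 / (1 - x\<^sup>2)"

lemma strict_mono_on_block_gf: "strict_mono_on {0<..<1} block_gf"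
proof (rule strict_mono_onI)
  fix x y :: real
  assume "x \<in> {0<..<1}" "y \<in> {0<..<1}" "x < y"
  then have "x\<^sup>2 < y\<^sup>2" "y\<^sup>2 < 1"
    by (simp_all add: power_strict_mono power_less_one_iff)
  then have "x\<^sup>2 / (1 - x\<^sup>2) < y\<^sup>2 / (1 - y\<^sup>2)"
    by (intro frac_less) auto
  with \<open>x < y\<close> show "block_gf x < block_gf y"
    by (simp add: block_gf_def)
qed

lemma block_gf_sign_change: "block_gf (5549 / 10000) < 1" "1 < block_gf (555 / 1000)"
  by (simp_all add: block_gf_def power2_eq_square)

lemma block_gf_eq_1_imp_bounds:
  assumes "0 < x" "x < 1" "block_gf x = 1"
  shows "5549 / 10000 < x" "x < 555 / 1000"
  using assms block_gf_sign_change
    strict_mono_on_less[OF strict_mono_on_block_gf, of x "555 / 1000"]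
    strict_mono_on_less[OF strict_mono_on_block_gf, of "5549 / 10000" x]
  by simp_all

lemma ex1_block_gf_eq_1: "\<exists>!x. 0 < x \<and> x < 1 \<and> block_gf x = 1"
proof -
  have "continuous_on {5549 / 10000..555 / 1000} block_gf"
    unfolding block_gf_def
    by (intro continuous_intros) (auto simp: power2_eq_1_iff)
  then obtain r where "5549 / 10000 \<le> r" "r \<le> 555 / 1000" "block_gf r = 1"
    using block_gf_sign_change IVT'[of block_gf "5549 / 10000" 1 "555 / 1000"] by auto
  moreover have "x = y"
    if "0 < x" "x < 1" "block_gf x = 1" "0 < y" "y < 1" "block_gf y = 1" for x y
    using that strict_mono_on_eq[OF strict_mono_on_block_gf, of x y] by simp
  ultimately show ?thesis
    by (intro ex_ex1I exI[of _ r]) auto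
qed

lemma block_gf_inverse_eq_1_iff:
  assumes "1 < \<beta>"
  shows "block_gf (inverse \<beta>) = 1 \<longleftrightarrow> (\<beta>\<^sup>2 - 1) * (\<beta> - 1) = \<beta>"
proof -
  have "0 < \<beta>\<^sup>2 - 1"
    using assms one_less_power[of \<beta> 2] by simp
  have block_gf_inverse: "block_gf (inverse \<beta>) = 1 / \<beta> + 1 / (\<beta>\<^sup>2 - 1)"
    using assms \<open>0 < \<beta>\<^sup>2 - 1\<close> by (simp add: block_gf_def field_simps)
  have "1 / \<beta> + 1 / d = 1 \<longleftrightarrow> d * (\<beta> - 1) = \<beta>" if "0 < d" for d
    using assms that by (auto simp: field_simps)
  with block_gf_inverse \<open>0 < \<beta>\<^sup>2 - 1\<close> show ?thesis by simp
qed

lemma log_2_ge_849_thousandths: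
  fixes \<beta> :: real
  assumes "1000 / 555 \<le> \<beta>"
  shows "849 / 1000 \<le> log 2 \<beta>"
proof -
  have "(2::real) ^ 45 \<le> (1000 / 555) ^ 53"
    by (simp add: power_divide)
  also have "\<dots> \<le> \<beta> ^ 53"
    using assms by (intro power_mono) auto
  finally have "real 45 \<le> log 2 (\<beta> ^ 53)"
    by (intro le_log_of_power) auto
  then show ?thesis
    using assms by (simp add: log_nat_power)
qed

lemma log_2_less_850_thousandths:
  fixes \<beta> :: real
  assumes "0 < \<beta>" "\<beta> \<le> 10000 / 5549"
  shows "log 2 \<beta> < 850 / 1000"
proof -
  have "\<beta> ^ 20 \<le> (10000 / 5549) ^ 20"
    using assms by (intro power_mono) auto
  also have "\<dots> < (2::real) ^ 17"
    by (simp add: power_divide)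
  finally have "log 2 (\<beta> ^ 20) < log 2 (2 ^ 17)"
    using assms by (intro log_less) auto
  then show ?thesis
    using assms by (simp only: log_nat_power) simp
qed

theorem theorem2:
  shows "(\<exists>!x::real. 0 < x \<and> x < 1 \<and> x + x\<^sup>2 / (1 - x\<^sup>2) = 1) \<and>
    (\<forall>\<beta>::real. 0 < inverse \<beta> \<and> inverse \<beta> < 1 \<and>
        inverse \<beta> + (inverse \<beta>)\<^sup>2 / (1 - (inverse \<beta>)\<^sup>2) = 1 \<longrightarrow>
      shannon_markov_capacity G = ereal (log 2 \<beta>) \<and>
      849 / 1000 \<le> log 2 \<beta> \<and> log 2 \<beta> < 850 / 1000)"
  unfolding block_gf_def[symmetric]
proof (intro conjI allI impI ex1_block_gf_eq_1)
  fix \<beta> :: real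
  assume root: "0 < inverse \<beta> \<and> inverse \<beta> < 1 \<and> block_gf (inverse \<beta>) = 1"
  then have "1 < \<beta>" by (auto simp: inverse_less_1_iff)
  have "(\<beta>\<^sup>2 - 1) * (\<beta> - 1) = \<beta>"
    using root block_gf_inverse_eq_1_iff[OF \<open>1 < \<beta>\<close>] by simp
  then show "shannon_markov_capacity G = ereal (log 2 \<beta>)"
    using \<open>1 < \<beta>\<close>
    by (intro shannon_markov_capacity_eq_log bigthetaI
        max_code_size_G_bigo max_code_size_G_bigomega) auto
  have bounds: "1000 / 555 \<le> \<beta>" "\<beta> \<le> 10000 / 5549"
    using block_gf_eq_1_imp_bounds[of "inverse \<beta>"] root \<open>1 < \<beta>\<close> by (simp_all add: field_simps)
  show "849 / 1000 \<le> log 2 \<beta>" "log 2 \<beta> < 850 / 1000"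
    using \<open>1 < \<beta>\<close> log_2_ge_849_thousandths[OF bounds(1)] log_2_less_850_thousandths[OF _ bounds(2)]
    by simp_all
qed

end
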